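(* Let $R$ be a ring, let $n\in\mathbb{N}$, and let $\phi/\psi\in\mathcal{L}(R)$ be a pp-pair where $\phi$ and $\psi$ are pp-$n$-formulas. Let free realisations $(C,\overline{c})$ and $(D,\overline{d})$ of $\phi$ and $\psi$ be given, respectively. Then $$w(\phi/\psi)\cong\{\overline{r}\cdot\overline{c}:\overline{r}\in R^n\text{ such that }\overline{r}\cdot\overline{d}=0\}.$$
   Context: $R\text{-}\mathrm{Mod}$, $R\text{-}\mathrm{mod}$ are the categories of left, resp. finitely presented left, $R$-modules. $\mathcal{L}(R)$ is the category of functors $F:R\text{-}\mathrm{Mod}\to\mathrm{Ab}$ for which there is an exact sequence $\mathrm{Hom}_R(B,-)\to\mathrm{Hom}_R(A,-)\to F\to 0$ with $A,B\in R\text{-}\mathrm{mod}$ (an abelian category, kernels and cokernels computed objectwise). $U:R\text{-}\mathrm{Mod}\to\mathrm{Ab}$ is the forgetful functor. A pp-$n$-formula is a subfunctor of $U^n$ lying in $\mathcal{L}(R)$; a pp-pair is a quotient $\phi/\psi$ of pp formulas with $\psi\leqslant\phi$ (inclusion). A free realisation of a pp-$n$-formula $\phi$ is a pair $(C,\overline{c})$ with $C\in R\text{-}\mathrm{mod}$ and $\overline{c}\in C^n$ such that the image of the natural transformation $\mathrm{Hom}_R(C,-)\to U^n$, $f\mapsto f\overline{c}$, is $\phi$. The defect $w$ is the contravariant functor sending a finitely presented functor $F:R\text{-}\mathrm{Mod}\to\mathrm{Ab}$ to a left $R$-module, given as the left adjoint $\mathrm{fp}(R\text{-}\mathrm{Mod},\mathrm{Ab})\to(R\text{-}\mathrm{Mod})^{\mathrm{op}}$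 of $M\mapsto\mathrm{Hom}_R(M,-)$; explicitly, if $\mathrm{Hom}_R(B,-)\to\mathrm{Hom}_R(A,-)\to F\to 0$ is exact and the first map is induced by $f:A\to B$, then $wF\cong\mathrm{Ker}(f)$. The isomorphism is one of left $R$-modules, the right-hand side being a submodule of $C$. Notation: $\overline{r}\cdot\overline{c}=\sum_{i=1}^n r_ic_i$. *)

theory Defs
  imports "HOL-Algebra.Module" "HOL-Algebra.Product_Groups"
begin

section \<open>Left modules over a not necessarily commutative ring\<close>

text \<open>The locale \<^locale>\<open>module\<close> of the library requires a commutative ring of scalars. We keep its
  record type (whose inherited fields \<open>mult\<close> and \<open>one\<close> are irrelevant) and its axioms, but
  allow an arbitrary unital associative ring.\<close>

locale left_module = R?: ring R + M?: abelian_group M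
  for R :: "('r, 'x) ring_scheme" (structure) and M :: "('r, 'm) module" (structure) +
  assumes smult_closed [simp, intro]:
      "\<lbrakk>a \<in> carrier R; x \<in> carrier M\<rbrakk> \<Longrightarrow> a \<odot>\<^bsub>M\<^esub> x \<in> carrier M"
    and smult_l_distr:
      "\<lbrakk>a \<in> carrier R; b \<in> carrier R; x \<in> carrier M\<rbrakk> \<Longrightarrow>
        (a \<oplus> b) \<odot>\<^bsub>M\<^esub> x = a \<odot>\<^bsub>M\<^esub> x \<oplus>\<^bsub>M\<^esub> b \<odot>\<^bsub>M\<^esub> x"
    and smult_r_distr:
      "\<lbrakk>a \<in> carrier R; x \<in> carrier M; y \<in> carrier M\<rbrakk> \<Longrightarrow>
        a \<odot>\<^bsub>M\<^esub> (x \<oplus>\<^bsub>M\<^esub> y) = a \<odot>\<^bsub>M\<^esub> x \<oplus>\<^bsub>M\<^esub> a \<odot>\<^bsub>M\<^esub> y"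
    and smult_assoc1:
      "\<lbrakk>a \<in> carrier R; b \<in> carrier R; x \<in> carrier M\<rbrakk> \<Longrightarrow>
        (a \<otimes> b) \<odot>\<^bsub>M\<^esub> x = a \<odot>\<^bsub>M\<^esub> (b \<odot>\<^bsub>M\<^esub> x)"
    and smult_one [simp]:
      "x \<in> carrier M \<Longrightarrow> \<one> \<odot>\<^bsub>M\<^esub> x = x"

text \<open>Homomorphisms are extensional functions, so that equality of morphisms is equality in HOL.\<close>

definition mod_hom ::
    "('r, 'x) ring_scheme \<Rightarrow> ('r, 'm) module \<Rightarrow> ('r, 'k) module \<Rightarrow> ('m \<Rightarrow> 'k) set" where
  "mod_hom R M N =
     {f \<in> extensional (carrier M). f \<in> hom (add_monoid M) (add_monoid N) \<and>
        (\<forall>r\<in>carrier R. \<forall>x\<in>carrier M. f (r \<odot>\<^bsub>M\<^esub> x) = r \<odot>\<^bsub>N\<^esub> f x)}"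

definition mod_iso :: "('r, 'x) ring_scheme \<Rightarrow> ('r, 'm) module \<Rightarrow> ('r, 'k) module \<Rightarrow> bool" where
  "mod_iso R M N \<longleftrightarrow> left_module R M \<and> left_module R N \<and>
     (\<exists>h\<in>mod_hom R M N. bij_betw h (carrier M) (carrier N))"

definition free_mod :: "('r, 'x) ring_scheme \<Rightarrow> nat \<Rightarrow> ('r, nat \<Rightarrow> 'r) module" where
  "free_mod R n =
     \<lparr>carrier = (\<Pi>\<^sub>E i\<in>{..<n}. carrier R),
      mult = (\<lambda>x y. \<lambda>i\<in>{..<n}. x i \<otimes>\<^bsub>R\<^esub> y i), one = (\<lambda>i\<in>{..<n}. \<one>\<^bsub>R\<^esub>),
      zero = (\<lambda>i\<in>{..<n}. \<zero>\<^bsub>R\<^esub>), add = (\<lambda>x y. \<lambda>i\<in>{..<n}. x i \<oplus>\<^bsub>R\<^esub> y i),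
      smult = (\<lambda>r x. \<lambda>i\<in>{..<n}. r \<otimes>\<^bsub>R\<^esub> x i)\<rparr>"

text \<open>Finite presentability: there is an exact sequence \<open>R\<^sup>k \<rightarrow> R\<^sup>n \<rightarrow> M \<rightarrow> 0\<close>.\<close>

definition fin_pres :: "('r, 'x) ring_scheme \<Rightarrow> ('r, 'm) module \<Rightarrow> bool" where
  "fin_pres R M \<longleftrightarrow> left_module R M \<and>
     (\<exists>k n. \<exists>g\<in>mod_hom R (free_mod R k) (free_mod R n). \<exists>p\<in>mod_hom R (free_mod R n) M.
        p ` carrier (free_mod R n) = carrier M \<and>
        kernel (add_monoid (free_mod R n)) (add_monoid M) p = g ` carrier (free_mod R k))"


section \<open>Functors from left modules to abelian groups\<close>

text \<open>The category of left \<open>R\<close>-modules consists of the modules whose carrier is a set of elements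
  of a fixed type \<open>'m\<close>, which plays the role of the universe and is arbitrary throughout.
  The values of a functor are abelian groups on another type \<open>'v\<close>; \<open>arr F M N f\<close> is the value
  of \<open>F\<close> at \<open>f : M \<rightarrow> N\<close>. Only the behaviour on modules, on homomorphisms and on the carriers of
  the values is meaningful.\<close>

record ('r, 'm, 'v) mfunctor =
  obj :: "('r, 'm) module \<Rightarrow> 'v monoid"
  arr :: "('r, 'm) module \<Rightarrow> ('r, 'm) module \<Rightarrow> ('m \<Rightarrow> 'm) \<Rightarrow> 'v \<Rightarrow> 'v"

definition is_functor :: "('r, 'x) ring_scheme \<Rightarrow> ('r, 'm, 'v) mfunctor \<Rightarrow> bool" where
  "is_functor R F \<longleftrightarrow>
     (\<forall>M. left_module R M \<longrightarrow> comm_group (obj F M)) \<and>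
     (\<forall>M N. left_module R M \<longrightarrow> left_module R N \<longrightarrow>
        (\<forall>f\<in>mod_hom R M N. arr F M N f \<in> hom (obj F M) (obj F N))) \<and>
     (\<forall>M. left_module R M \<longrightarrow>
        (\<forall>x\<in>carrier (obj F M). arr F M M (\<lambda>m\<in>carrier M. m) x = x)) \<and>
     (\<forall>M N P. left_module R M \<longrightarrow> left_module R N \<longrightarrow> left_module R P \<longrightarrow>
        (\<forall>f\<in>mod_hom R M N. \<forall>g\<in>mod_hom R N P. \<forall>x\<in>carrier (obj F M).
           arr F M P (compose (carrier M) g f) x = arr F N P g (arr F M N f x)))"

definition nat_trans ::
    "('r, 'x) ring_scheme \<Rightarrow> ('r, 'm, 'v) mfunctor \<Rightarrow> ('r, 'm, 'w) mfunctor \<Rightarrow>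
     (('r, 'm) module \<Rightarrow> 'v \<Rightarrow> 'w) \<Rightarrow> bool" where
  "nat_trans R F G \<alpha> \<longleftrightarrow>
     (\<forall>M. left_module R M \<longrightarrow> \<alpha> M \<in> hom (obj F M) (obj G M)) \<and>
     (\<forall>M N. left_module R M \<longrightarrow> left_module R N \<longrightarrow>
        (\<forall>f\<in>mod_hom R M N. \<forall>x\<in>carrier (obj F M).
           \<alpha> N (arr F M N f x) = arr G M N f (\<alpha> M x)))"

definition hom_functor ::
    "('r, 'x) ring_scheme \<Rightarrow> ('r, 'm) module \<Rightarrow> ('r, 'm, 'm \<Rightarrow> 'm) mfunctor" where
  "hom_functor R A =
     \<lparr>obj = (\<lambda>M. \<lparr>carrier = mod_hom R A M,
                  mult = (\<lambda>f g. \<lambda>x\<in>carrier A. f x \<oplus>\<^bsub>M\<^esub> g x),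
                  one = (\<lambda>x\<in>carrier A. \<zero>\<^bsub>M\<^esub>)\<rparr>),
      arr = (\<lambda>M N g f. compose (carrier A) g f)\<rparr>"

text \<open>The \<open>n\<close>-th power of the forgetful functor.\<close>

definition forget_power :: "nat \<Rightarrow> ('r, 'm, nat \<Rightarrow> 'm) mfunctor" where
  "forget_power n =
     \<lparr>obj = (\<lambda>M. product_group {..<n} (\<lambda>_. add_monoid M)),
      arr = (\<lambda>M N f x. \<lambda>i\<in>{..<n}. f (x i))\<rparr>"

text \<open>Subfunctors are given by their carriers.\<close>

definition is_subfunctor ::
    "('r, 'x) ring_scheme \<Rightarrow> ('r, 'm, 'v) mfunctor \<Rightarrow> (('r, 'm) module \<Rightarrow> 'v set) \<Rightarrow> bool" where
  "is_subfunctor R F S \<longleftrightarrow>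
     (\<forall>M. left_module R M \<longrightarrow> subgroup (S M) (obj F M)) \<and>
     (\<forall>M N. left_module R M \<longrightarrow> left_module R N \<longrightarrow>
        (\<forall>f\<in>mod_hom R M N. arr F M N f ` S M \<subseteq> S N))"

definition subfunctor ::
    "('r, 'm, 'v) mfunctor \<Rightarrow> (('r, 'm) module \<Rightarrow> 'v set) \<Rightarrow> ('r, 'm, 'v) mfunctor" where
  "subfunctor F S = \<lparr>obj = (\<lambda>M. (obj F M)\<lparr>carrier := S M\<rparr>), arr = arr F\<rparr>"

definition quotient_functor ::
    "('r, 'm, 'v) mfunctor \<Rightarrow> (('r, 'm) module \<Rightarrow> 'v set) \<Rightarrow> ('r, 'm, 'v set) mfunctor" where
  "quotient_functor F S =
     \<lparr>obj = (\<lambda>M. obj F M Mod S M),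
      arr = (\<lambda>M N f X. \<Union>x\<in>X. S N #>\<^bsub>obj F N\<^esub> arr F M N f x)\<rparr>"

text \<open>Membership in \<open>\<L>(R)\<close>: exactness of \<open>Hom(B,-) \<rightarrow> Hom(A,-) \<rightarrow> F \<rightarrow> 0\<close> is objectwise.\<close>

definition in_L :: "('r, 'x) ring_scheme \<Rightarrow> ('r, 'm, 'v) mfunctor \<Rightarrow> bool" where
  "in_L R F \<longleftrightarrow> is_functor R F \<and>
     (\<exists>A B \<alpha> \<beta>. fin_pres R A \<and> fin_pres R B \<and>
        nat_trans R (hom_functor R B) (hom_functor R A) \<alpha> \<and>
        nat_trans R (hom_functor R A) F \<beta> \<and>
        (\<forall>M. left_module R M \<longrightarrow>
           kernel (obj (hom_functor R A) M) (obj F M) (\<beta> M) =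
             \<alpha> M ` carrier (obj (hom_functor R B) M) \<and>
           \<beta> M ` carrier (obj (hom_functor R A) M) = carrier (obj F M)))"


section \<open>pp formulas, pp-pairs and free realisations\<close>

definition pp_formula ::
    "('r, 'x) ring_scheme \<Rightarrow> nat \<Rightarrow> (('r, 'm) module \<Rightarrow> (nat \<Rightarrow> 'm) set) \<Rightarrow> bool" where
  "pp_formula R n \<phi> \<longleftrightarrow>
     is_subfunctor R (forget_power n) \<phi> \<and> in_L R (subfunctor (forget_power n) \<phi>)"

definition pp_quotient ::
    "nat \<Rightarrow> (('r, 'm) module \<Rightarrow> (nat \<Rightarrow> 'm) set) \<Rightarrow> (('r, 'm) module \<Rightarrow> (nat \<Rightarrow> 'm) set) \<Rightarrow>
     ('r, 'm, (nat \<Rightarrow> 'm) set) mfunctor" where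
  "pp_quotient n \<phi> \<psi> = quotient_functor (subfunctor (forget_power n) \<phi>) \<psi>"

definition pp_pair ::
    "('r, 'x) ring_scheme \<Rightarrow> nat \<Rightarrow> (('r, 'm) module \<Rightarrow> (nat \<Rightarrow> 'm) set) \<Rightarrow>
     (('r, 'm) module \<Rightarrow> (nat \<Rightarrow> 'm) set) \<Rightarrow> bool" where
  "pp_pair R n \<phi> \<psi> \<longleftrightarrow> pp_formula R n \<phi> \<and> pp_formula R n \<psi> \<and>
     (\<forall>M. left_module R M \<longrightarrow> \<psi> M \<subseteq> \<phi> M)"

definition free_realisation ::
    "('r, 'x) ring_scheme \<Rightarrow> nat \<Rightarrow> (('r, 'm) module \<Rightarrow> (nat \<Rightarrow> 'm) set) \<Rightarrow>
     ('r, 'm) module \<Rightarrow> (nat \<Rightarrow> 'm) \<Rightarrow> bool" where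
  "free_realisation R n \<phi> C c \<longleftrightarrow>
     fin_pres R C \<and> c \<in> carrier (obj (forget_power n) C) \<and>
     (\<forall>M. left_module R M \<longrightarrow>
        (\<lambda>f. arr (forget_power n) C M f c) ` carrier (obj (hom_functor R C) M) = \<phi> M)"

text \<open>The sum \<open>\<Sum>\<^sub>i r\<^sub>i c\<^sub>i\<close>.\<close>

definition lincomb :: "('r, 'm) module \<Rightarrow> nat \<Rightarrow> (nat \<Rightarrow> 'r) \<Rightarrow> (nat \<Rightarrow> 'm) \<Rightarrow> 'm" where
  "lincomb C n r c = (\<Oplus>\<^bsub>C\<^esub>i\<in>{..<n}. r i \<odot>\<^bsub>C\<^esub> c i)"


section \<open>The defect\<close>

text \<open>The defect is left adjoint to the contravariant Yoneda functor
  \<open>M \<mapsto> Hom(M,-)\<close>, as a functor into the opposite of the category of modules. So \<open>W\<close> is its value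
  at \<open>F\<close> iff there is a universal arrow (the unit) \<open>\<eta> : F \<rightarrow> Hom(W,-)\<close>: every natural
  transformation \<open>\<alpha> : F \<rightarrow> Hom(M,-)\<close> is \<open>\<eta>\<close> followed by precomposition with a unique
  homomorphism \<open>h : M \<rightarrow> W\<close>.\<close>

definition is_defect ::
    "('r, 'x) ring_scheme \<Rightarrow> ('r, 'm, 'v) mfunctor \<Rightarrow> ('r, 'm) module \<Rightarrow> bool" where
  "is_defect R F W \<longleftrightarrow> left_module R W \<and>
     (\<exists>\<eta>. nat_trans R F (hom_functor R W) \<eta> \<and>
        (\<forall>M \<alpha>. left_module R M \<longrightarrow> nat_trans R F (hom_functor R M) \<alpha> \<longrightarrow>
           (\<exists>!h. h \<in> mod_hom R M W \<and>
              (\<forall>N. left_module R N \<longrightarrow>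
                 (\<forall>x\<in>carrier (obj F N). \<alpha> N x = compose (carrier M) (\<eta> N x) h)))))"

definition defect ::
    "('r, 'x) ring_scheme \<Rightarrow> ('r, 'm, 'v) mfunctor \<Rightarrow> ('r, 'm) module" where
  "defect R F = (SOME W. is_defect R F W)"


subsection \<open>The defect is well defined for finitely presented functors\<close>


lemma mod_homD:
  assumes "f \<in> mod_hom R M N"
  shows "f \<in> extensional (carrier M)"
    and "\<And>x. x \<in> carrier M \<Longrightarrow> f x \<in> carrier N"
    and "\<And>x y. x \<in> carrier M \<Longrightarrow> y \<in> carrier M \<Longrightarrow> f (x \<oplus>\<^bsub>M\<^esub> y) = f x \<oplus>\<^bsub>N\<^esub> f y"
    and "\<And>r x. r \<in> carrier R \<Longrightarrow> x \<in> carrier M \<Longrightarrow> f (r \<odot>\<^bsub>M\<^esub> x) = r \<odot>\<^bsub>N\<^esub> f x"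
  using assms by (auto simp: mod_hom_def hom_def)

lemma mod_homI:
  assumes "f \<in> extensional (carrier M)"
    and "\<And>x. x \<in> carrier M \<Longrightarrow> f x \<in> carrier N"
    and "\<And>x y. x \<in> carrier M \<Longrightarrow> y \<in> carrier M \<Longrightarrow> f (x \<oplus>\<^bsub>M\<^esub> y) = f x \<oplus>\<^bsub>N\<^esub> f y"
    and "\<And>r x. r \<in> carrier R \<Longrightarrow> x \<in> carrier M \<Longrightarrow> f (r \<odot>\<^bsub>M\<^esub> x) = r \<odot>\<^bsub>N\<^esub> f x"
  shows "f \<in> mod_hom R M N"
  using assms by (auto simp: mod_hom_def hom_def)

lemma mod_hom_id:
  assumes "left_module R M"
  shows "(\<lambda>m\<in>carrier M. m) \<in> mod_hom R M M"
proof -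
  interpret left_module R M by fact
  show ?thesis by (rule mod_homI) auto
qed

lemma mod_hom_compose:
  assumes "left_module R M" "f \<in> mod_hom R M N" "g \<in> mod_hom R N P"
  shows "compose (carrier M) g f \<in> mod_hom R M P"
proof -
  interpret left_module R M by fact
  show ?thesis
    by (rule mod_homI) (auto simp: compose_eq mod_homD[OF assms(2)] mod_homD[OF assms(3)])
qed

lemma mod_hom_zero:
  assumes "left_module R M" "left_module R N" "f \<in> mod_hom R M N"
  shows "f \<zero>\<^bsub>M\<^esub> = \<zero>\<^bsub>N\<^esub>"
proof -
  interpret M: left_module R M by fact
  interpret N: left_module R N by fact
  have "f \<zero>\<^bsub>M\<^esub> \<oplus>\<^bsub>N\<^esub> f \<zero>\<^bsub>M\<^esub> = f \<zero>\<^bsub>M\<^esub>"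
    using mod_homD(3)[OF assms(3), of "\<zero>\<^bsub>M\<^esub>" "\<zero>\<^bsub>M\<^esub>"] by simp
  then show ?thesis using mod_homD(2)[OF assms(3)] by (metis M.M.zero_closed N.M.add.r_cancel_one)
qed

lemma (in left_module) smult_zero_right: "a \<in> carrier R \<Longrightarrow> a \<odot>\<^bsub>M\<^esub> \<zero>\<^bsub>M\<^esub> = \<zero>\<^bsub>M\<^esub>"
  by (metis M.add.r_cancel_one M.zero_closed M.l_zero smult_closed smult_r_distr)

lemma (in left_module) smult_minus: "a \<in> carrier R \<Longrightarrow> x \<in> carrier M \<Longrightarrow> a \<odot>\<^bsub>M\<^esub> (\<ominus>\<^bsub>M\<^esub> x) = \<ominus>\<^bsub>M\<^esub> (a \<odot>\<^bsub>M\<^esub> x)"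
  by (metis M.add.inv_closed M.l_neg M.minus_equality smult_closed smult_r_distr smult_zero_right)

lemma hom_functor_comm_group:
  assumes "left_module R A" "left_module R M"
  shows "comm_group (obj (hom_functor R A) M)"
proof -
  interpret A: left_module R A by fact
  interpret M: left_module R M by fact
  show ?thesis
  proof (rule comm_groupI; simp add: hom_functor_def)
    fix f g assume f: "f \<in> mod_hom R A M" and g: "g \<in> mod_hom R A M"
    show "(\<lambda>x\<in>carrier A. f x \<oplus>\<^bsub>M\<^esub> g x) \<in> mod_hom R A M"
      by (rule mod_homI) (auto simp: mod_homD[OF f] mod_homD[OF g] M.smult_r_distr M.M.a_ac)
    show "(\<lambda>x\<in>carrier A. f x \<oplus>\<^bsub>M\<^esub> g x) = (\<lambda>x\<in>carrier A. g x \<oplus>\<^bsub>M\<^esub> f x)"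
      by (auto simp: fun_eq_iff mod_homD[OF f] mod_homD[OF g] M.M.a_comm)
  next
    show "(\<lambda>x\<in>carrier A. \<zero>\<^bsub>M\<^esub>) \<in> mod_hom R A M"
      by (rule mod_homI) (auto simp: M.smult_zero_right)
  next
    fix f assume f: "f \<in> mod_hom R A M"
    show "(\<lambda>x\<in>carrier A. (if x \<in> carrier A then \<zero>\<^bsub>M\<^esub> else undefined) \<oplus>\<^bsub>M\<^esub> f x) = f" 
      using mod_homD[OF f] by (auto simp: fun_eq_iff extensional_def)
    show "\<exists>g\<in>mod_hom R A M. (\<lambda>x\<in>carrier A. g x \<oplus>\<^bsub>M\<^esub> f x) = (\<lambda>x\<in>carrier A. \<zero>\<^bsub>M\<^esub>)"
    proof (rule bexI[of _ "\<lambda>x\<in>carrier A. \<ominus>\<^bsub>M\<^esub> f x"])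
      show "(\<lambda>x\<in>carrier A. \<ominus>\<^bsub>M\<^esub> f x) \<in> mod_hom R A M"
        by (rule mod_homI) (auto simp: mod_homD[OF f] M.smult_minus M.M.minus_add M.M.a_ac)
    qed (auto simp: fun_eq_iff mod_homD[OF f] M.M.l_neg)
  next
    fix f g h assume f: "f \<in> mod_hom R A M" and g: "g \<in> mod_hom R A M" and h: "h \<in> mod_hom R A M"
    show "(\<lambda>x\<in>carrier A. (if x \<in> carrier A then f x \<oplus>\<^bsub>M\<^esub> g x else undefined) \<oplus>\<^bsub>M\<^esub> h x) =
          (\<lambda>x\<in>carrier A. f x \<oplus>\<^bsub>M\<^esub> (if x \<in> carrier A then g x \<oplus>\<^bsub>M\<^esub> h x else undefined))"
      by (auto simp: fun_eq_iff mod_homD[OF f] mod_homD[OF g] mod_homD[OF h] M.M.a_assoc)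
  qed
qed


lemma kernel_left_module:
  assumes A: "left_module R A" and B: "left_module R B" and f: "f \<in> mod_hom R A B"
  shows "left_module R (A\<lparr>carrier := kernel (add_monoid A) (add_monoid B) f\<rparr>)" (is "left_module R ?K")
proof -
  interpret A: left_module R A by fact
  interpret B: left_module R B by fact
  have K: "\<And>x. x \<in> carrier ?K \<longleftrightarrow> x \<in> carrier A \<and> f x = \<zero>\<^bsub>B\<^esub>"
    by (simp add: kernel_def)
  have inv: "\<exists>y\<in>carrier ?K. y \<oplus>\<^bsub>?K\<^esub> x = \<zero>\<^bsub>?K\<^esub>" if "x \<in> carrier ?K" for x
  proof -
    have x: "x \<in> carrier A" "f x = \<zero>\<^bsub>B\<^esub>" using that K by auto
    have "f (\<ominus>\<^bsub>A\<^esub> x) \<oplus>\<^bsub>B\<^esub> f x = \<zero>\<^bsub>B\<^esub>"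
      using x mod_homD(3)[OF f, of "\<ominus>\<^bsub>A\<^esub> x" x] by (simp add: A.M.l_neg mod_hom_zero[OF A B f])
    then show ?thesis
      using x mod_homD(2)[OF f, of "\<ominus>\<^bsub>A\<^esub> x"]
      by (intro bexI[of _ "\<ominus>\<^bsub>A\<^esub> x"]) (auto simp: A.M.l_neg kernel_def)
  qed
  have "abelian_group ?K"
    by (rule abelian_groupI[OF _ _ _ _ _ inv])
       (auto simp: kernel_def mod_homD[OF f] mod_hom_zero[OF A B f] A.M.a_ac)
  then show ?thesis
    by (intro left_module.intro A.R.ring_axioms left_module_axioms.intro)
       (auto simp: kernel_def mod_homD[OF f] B.smult_zero_right A.smult_l_distr A.smult_r_distr A.smult_assoc1)
qed

text \<open>The explicit description of the defect as a kernel.\<close>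

lemma is_defect_kernel:
  fixes A B :: "('a, 'c) module"
  assumes A: "left_module R A" and B: "left_module R B" and f: "f \<in> mod_hom R A B"
    and F: "is_functor R F" and \<beta>: "nat_trans R (hom_functor R A) F \<beta>"
    and ex: "\<And>M. left_module R M \<Longrightarrow> kernel (obj (hom_functor R A) M) (obj F M) (\<beta> M) =
               (\<lambda>g. compose (carrier A) g f) ` mod_hom R B M"
    and surj: "\<And>M. left_module R M \<Longrightarrow> \<beta> M ` mod_hom R A M = carrier (obj F M)"
  shows "is_defect R F (A\<lparr>carrier := kernel (add_monoid A) (add_monoid B) f\<rparr>)" (is "is_defect R F ?K")
proof -
  interpret A: left_module R A by fact
  interpret B: left_module R B by fact
  have Kmod: "left_module R ?K" by (rule kernel_left_module[OF A B f])
  have K: "x \<in> carrier ?K \<longleftrightarrow> x \<in> carrier A \<and> f x = \<zero>\<^bsub>B\<^esub>" for x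
    by (simp add: kernel_def)
  have \<beta>hom: "\<beta> M \<in> hom (obj (hom_functor R A) M) (obj F M)" if "left_module R M" for M
    using \<beta> that by (simp add: nat_trans_def)
  have \<beta>nat: "\<beta> N (compose (carrier A) k g) = arr F M N k (\<beta> M g)"
    if "left_module R M" "left_module R N" "k \<in> mod_hom R M N" "g \<in> mod_hom R A M" for M N k g
    using \<beta> that by (simp add: nat_trans_def hom_functor_def)
  have wd: "g x = g' x"
    if M: "left_module R M" and g: "g \<in> mod_hom R A M" and g': "g' \<in> mod_hom R A M"
      and eq: "\<beta> M g = \<beta> M g'" and x: "x \<in> carrier ?K" for M g g' x
  proof -
    interpret M: left_module R M by fact
    interpret H: comm_group "obj (hom_functor R A) M" by (rule hom_functor_comm_group[OF A M])
    interpret FM: comm_group "obj F M" using F M by (simp add: is_functor_def)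
    interpret b: group_hom "obj (hom_functor R A) M" "obj F M" "\<beta> M"
      by (unfold_locales) (rule \<beta>hom[OF M])
    let ?H = "obj (hom_functor R A) M"
    have gc: "g \<in> carrier ?H" "g' \<in> carrier ?H" using g g' by (auto simp: hom_functor_def)
    let ?d = "g \<otimes>\<^bsub>?H\<^esub> inv\<^bsub>?H\<^esub> g'"
    have "?d \<in> kernel ?H (obj F M) (\<beta> M)"
      using gc eq by (simp add: kernel_def)
    then obtain k where k: "k \<in> mod_hom R B M" and dk: "?d = compose (carrier A) k f"
      using ex[OF M] by auto
    have hm: "(a \<otimes>\<^bsub>?H\<^esub> b) x = a x \<oplus>\<^bsub>M\<^esub> b x" for a b
      using x by (simp add: hom_functor_def kernel_def)
    have "g = ?d \<otimes>\<^bsub>?H\<^esub> g'" using gc by (simp add: H.m_assoc)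
    then have "g x = ?d x \<oplus>\<^bsub>M\<^esub> g' x"
      using hm[of ?d g'] by (rule subst[where P = "\<lambda>u. u x = _", OF sym])
    moreover have "?d x = \<zero>\<^bsub>M\<^esub>"
      using x unfolding dk K by (simp add: compose_eq mod_hom_zero[OF B M k])
    ultimately show ?thesis using x K mod_homD(2)[OF g'] by simp
  qed
  define \<eta> where "\<eta> M y = restrict (SOME g. g \<in> mod_hom R A M \<and> \<beta> M g = y) (carrier ?K)" for M y
  have \<eta>: "\<eta> M (\<beta> M g) = restrict g (carrier ?K)" if M: "left_module R M" and g: "g \<in> mod_hom R A M" for M g
  proof -
    have "(SOME g'. g' \<in> mod_hom R A M \<and> \<beta> M g' = \<beta> M g) \<in> mod_hom R A M \<and>
          \<beta> M (SOME g'. g' \<in> mod_hom R A M \<and> \<beta> M g' = \<beta> M g) = \<beta> M g"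
      by (rule someI[of "\<lambda>g'. g' \<in> mod_hom R A M \<and> \<beta> M g' = \<beta> M g" g]) (use g in blast)
    then show ?thesis unfolding \<eta>_def using wd[OF M _ g] by (intro restrict_ext) blast
  qed
  have res: "restrict g (carrier ?K) \<in> mod_hom R ?K M" if g: "g \<in> mod_hom R A M" for M g
    using left_module.smult_closed[OF Kmod] abelian_groupE(1)[OF left_module.axioms(2)[OF Kmod]]
    by (intro mod_homI) (auto simp: mod_homD[OF g] kernel_def)
  have \<eta>nat: "nat_trans R F (hom_functor R ?K) \<eta>"
    unfolding nat_trans_def
  proof (intro conjI allI impI ballI)
    fix M :: "('a, 'c) module" assume M: "left_module R M"
    show "\<eta> M \<in> hom (obj F M) (obj (hom_functor R ?K) M)"
    proof (rule homI)
      fix y assume "y \<in> carrier (obj F M)"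
      then obtain g where g: "g \<in> mod_hom R A M" "y = \<beta> M g" using surj[OF M] by auto
      show "\<eta> M y \<in> carrier (obj (hom_functor R ?K) M)"
        using res[OF g(1)] by (simp add: g(2) \<eta>[OF M g(1)] hom_functor_def)
    next
      fix y z assume "y \<in> carrier (obj F M)" "z \<in> carrier (obj F M)"
      then obtain g h where g: "g \<in> mod_hom R A M" "y = \<beta> M g" and h: "h \<in> mod_hom R A M" "z = \<beta> M h"
        using surj[OF M] by (metis imageE)
      let ?s = "\<lambda>x\<in>carrier A. g x \<oplus>\<^bsub>M\<^esub> h x"
      interpret H: comm_group "obj (hom_functor R A) M" by (rule hom_functor_comm_group[OF A M])
      have s: "?s \<in> mod_hom R A M" using H.m_closed[of g h] g h by (simp add: hom_functor_def)
      have "\<beta> M ?s = y \<otimes>\<^bsub>obj F M\<^esub> z"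
        using hom_mult[OF \<beta>hom[OF M], of g h] g h by (simp add: hom_functor_def)
      then have "\<eta> M (y \<otimes>\<^bsub>obj F M\<^esub> z) = restrict ?s (carrier ?K)" using \<eta>[OF M s] by simp
      also have "\<dots> = \<eta> M y \<otimes>\<^bsub>obj (hom_functor R ?K) M\<^esub> \<eta> M z"
        by (auto simp: g h \<eta>[OF M g(1)] \<eta>[OF M h(1)] hom_functor_def kernel_def fun_eq_iff)
      finally show "\<eta> M (y \<otimes>\<^bsub>obj F M\<^esub> z) = \<eta> M y \<otimes>\<^bsub>obj (hom_functor R ?K) M\<^esub> \<eta> M z" .
    qed
  next
    fix M N :: "('a, 'c) module" and k y
    assume M: "left_module R M" and N: "left_module R N" and k: "k \<in> mod_hom R M N"
      and "y \<in> carrier (obj F M)"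
    then obtain g where g: "g \<in> mod_hom R A M" "y = \<beta> M g" using surj[OF M] by auto
    have "arr F M N k y = \<beta> N (compose (carrier A) k g)" using \<beta>nat[OF M N k g(1)] g by simp
    then have "\<eta> N (arr F M N k y) = restrict (compose (carrier A) k g) (carrier ?K)"
      using \<eta>[OF N mod_hom_compose[OF A g(1) k]] by simp
    also have "\<dots> = arr (hom_functor R ?K) M N k (\<eta> M y)"
      by (auto simp: g \<eta>[OF M g(1)] hom_functor_def kernel_def fun_eq_iff compose_def)
    finally show "\<eta> N (arr F M N k y) = arr (hom_functor R ?K) M N k (\<eta> M y)" .
  qed
  let ?id = "\<lambda>a\<in>carrier A. a"
  have id: "?id \<in> mod_hom R A A" by (rule mod_hom_id[OF A])
  have uni: "\<exists>!h. h \<in> mod_hom R M ?K \<and> (\<forall>N. left_module R N \<longrightarrow>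
               (\<forall>x\<in>carrier (obj F N). \<alpha> N x = compose (carrier M) (\<eta> N x) h))"
    if M: "left_module R M" and \<alpha>: "nat_trans R F (hom_functor R M) \<alpha>" for M \<alpha>
  proof -
    have \<alpha>hom: "\<alpha> N \<in> hom (obj F N) (obj (hom_functor R M) N)" if "left_module R N" for N
      using \<alpha> that by (simp add: nat_trans_def)
    have \<alpha>nat: "\<alpha> P (arr F N P k y) = compose (carrier M) k (\<alpha> N y)"
      if "left_module R N" "left_module R P" "k \<in> mod_hom R N P" "y \<in> carrier (obj F N)" for N P k y
      using \<alpha> that by (simp add: nat_trans_def hom_functor_def)
    have bc: "\<beta> A ?id \<in> carrier (obj F A)" using id surj[OF A] by auto
    let ?h = "\<alpha> A (\<beta> A ?id)"
    have h: "?h \<in> mod_hom R M A"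
      using hom_in_carrier[OF \<alpha>hom[OF A] bc] by (simp add: hom_functor_def)
    have yon: "\<alpha> N (\<beta> N g) = compose (carrier M) g ?h"
      if N: "left_module R N" and g: "g \<in> mod_hom R A N" for N g
    proof -
      have "compose (carrier A) g ?id = g"
        using mod_homD(1)[OF g] by (auto simp: compose_def fun_eq_iff extensional_def)
      then show ?thesis using \<beta>nat[OF A N g id] \<alpha>nat[OF A N g bc] by simp
    qed
    have "f \<in> kernel (obj (hom_functor R A) B) (obj F B) (\<beta> B)"
      unfolding ex[OF B]
    proof (rule image_eqI)
      show "f = compose (carrier A) (\<lambda>b\<in>carrier B. b) f"
        using mod_homD(1,2)[OF f] by (auto simp: compose_def fun_eq_iff extensional_def)
    qed (rule mod_hom_id[OF B])
    then have "\<beta> B f = \<one>\<^bsub>obj F B\<^esub>" by (simp add: kernel_def)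
    moreover have "group (obj F B)" using F B by (auto simp: is_functor_def comm_group_def)
    ultimately have "compose (carrier M) f ?h = (\<lambda>x\<in>carrier M. \<zero>\<^bsub>B\<^esub>)"
      using yon[OF B f] hom_one[OF \<alpha>hom[OF B]] hom_functor_comm_group[OF M B]
      by (simp add: hom_functor_def comm_group_def)
    then have fh: "f (?h m) = \<zero>\<^bsub>B\<^esub>" if "m \<in> carrier M" for m
      using that by (auto dest!: fun_cong[where x = m] simp: compose_eq)
    have hK: "?h \<in> mod_hom R M ?K"
      using fh mod_homD[OF h] by (intro mod_homI) (auto simp: kernel_def)
    have fac: "\<alpha> N x = compose (carrier M) (\<eta> N x) ?h"
      if N: "left_module R N" and x: "x \<in> carrier (obj F N)" for N x
    proof -
      obtain g where g: "g \<in> mod_hom R A N" "x = \<beta> N g" using surj[OF N] x by auto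
      show ?thesis using mod_homD(2)[OF hK]
        by (auto simp: g yon[OF N g(1)] \<eta>[OF N g(1)] compose_def fun_eq_iff)
    qed
    show ?thesis
    proof (intro ex1I conjI allI impI ballI)
      show "?h \<in> mod_hom R M ?K" by (rule hK)
    next
      fix N x assume "left_module R N" "x \<in> carrier (obj F N)"
      then show "\<alpha> N x = compose (carrier M) (\<eta> N x) ?h" by (rule fac)
    next
      fix h' assume h': "h' \<in> mod_hom R M ?K \<and> (\<forall>N. left_module R N \<longrightarrow>
               (\<forall>x\<in>carrier (obj F N). \<alpha> N x = compose (carrier M) (\<eta> N x) h'))"
      then have "?h = compose (carrier M) (restrict ?id (carrier ?K)) h'"
        using A bc \<eta>[OF A id] by simp
      also have "\<dots> = h'" using mod_homD(1,2)[of h' R M ?K] h'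
        by (auto simp: compose_def fun_eq_iff extensional_def kernel_def)
      finally show "h' = ?h" by simp
    qed
  qed
  show ?thesis unfolding is_defect_def
    by (intro conjI exI[of _ \<eta>] allI impI Kmod \<eta>nat uni)
qed

lemma is_defect_unique:
  fixes F :: "('a, 'c, 'd) mfunctor"
  assumes V: "is_defect R F V" and W: "is_defect R F W"
  shows "mod_iso R V W"
proof -
  define fac where "fac M U \<alpha> \<eta> h \<longleftrightarrow> h \<in> mod_hom R M U \<and>
      (\<forall>N. left_module R N \<longrightarrow> (\<forall>x\<in>carrier (obj F N). \<alpha> N x = compose (carrier M) (\<eta> N x) h))"
    for M U :: "('a, 'c) module" and \<alpha> \<eta> :: "('a, 'c) module \<Rightarrow> 'd \<Rightarrow> 'c \<Rightarrow> 'c" and h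
  obtain \<eta> where Vm: "left_module R V" and \<eta>: "nat_trans R F (hom_functor R V) \<eta>"
    and \<eta>u: "\<And>M \<alpha>. left_module R M \<Longrightarrow> nat_trans R F (hom_functor R M) \<alpha> \<Longrightarrow> \<exists>!h. fac M V \<alpha> \<eta> h"
    using V unfolding is_defect_def fac_def by blast
  obtain \<theta> where Wm: "left_module R W" and \<theta>: "nat_trans R F (hom_functor R W) \<theta>"
    and \<theta>u: "\<And>M \<alpha>. left_module R M \<Longrightarrow> nat_trans R F (hom_functor R M) \<alpha> \<Longrightarrow> \<exists>!h. fac M W \<alpha> \<theta> h"
    using W unfolding is_defect_def fac_def by blast
  obtain h where h: "fac V W \<eta> \<theta> h" using \<theta>u[OF Vm \<eta>] by blast
  obtain k where k: "fac W V \<theta> \<eta> k" using \<eta>u[OF Wm \<theta>] by blast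
  have comp: "fac M P \<alpha> \<gamma> (compose (carrier M) b a)"
    if "left_module R M" and a: "fac M N \<alpha> \<beta> a" and b: "fac N P \<beta> \<gamma> b" for M N P \<alpha> \<beta> \<gamma> a b
    using mod_hom_compose[of R M a N b P] that mod_homD(2)[of a R M N]
    by (auto simp: fac_def compose_def fun_eq_iff)
  have idf: "fac M M \<alpha> \<alpha> (\<lambda>m\<in>carrier M. m)"
    if M: "left_module R M" and \<alpha>: "nat_trans R F (hom_functor R M) \<alpha>" for M \<alpha>
  proof -
    have "\<alpha> N x \<in> extensional (carrier M)" if "left_module R N" "x \<in> carrier (obj F N)" for N x
      using hom_in_carrier[of "\<alpha> N" "obj F N" "obj (hom_functor R M) N" x] \<alpha> that
      by (auto simp: nat_trans_def hom_functor_def mod_hom_def)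
    then show ?thesis
      using mod_hom_id[OF M] by (auto simp: fac_def compose_def fun_eq_iff extensional_def)
  qed
  have 1: "compose (carrier V) k h = (\<lambda>m\<in>carrier V. m)"
    using \<eta>u[OF Vm \<eta>] comp[OF Vm h k] idf[OF Vm \<eta>] by blast
  have 2: "compose (carrier W) h k = (\<lambda>m\<in>carrier W. m)"
    using \<theta>u[OF Wm \<theta>] comp[OF Wm k h] idf[OF Wm \<theta>] by blast
  have hm: "h \<in> mod_hom R V W" and km: "k \<in> mod_hom R W V" using h k by (auto simp: fac_def)
  have "bij_betw h (carrier V) (carrier W)"
  proof (rule bij_betw_byWitness[where f' = k])
    show "\<forall>a\<in>carrier V. k (h a) = a" using 1 by (metis compose_eq restrict_apply')
    show "\<forall>a\<in>carrier W. h (k a) = a" using 2 by (metis compose_eq restrict_apply')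
  qed (use mod_homD(2)[OF hm] mod_homD(2)[OF km] in auto)
  then show ?thesis using Vm Wm hm by (auto simp: mod_iso_def)
qed

theorem defect_iso_kernel:
  fixes A B :: "('a, 'c) module"
  assumes "left_module R A" and "left_module R B" and "f \<in> mod_hom R A B"
    and "is_functor R F" and "nat_trans R (hom_functor R A) F \<beta>"
    and "\<And>M. left_module R M \<Longrightarrow> kernel (obj (hom_functor R A) M) (obj F M) (\<beta> M) =
               (\<lambda>g. compose (carrier A) g f) ` mod_hom R B M"
    and "\<And>M. left_module R M \<Longrightarrow> \<beta> M ` mod_hom R A M = carrier (obj F M)"
  shows "mod_iso R (defect R F) (A\<lparr>carrier := kernel (add_monoid A) (add_monoid B) f\<rparr>)"
  using is_defect_kernel[OF assms] is_defect_unique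
  unfolding defect_def by (metis someI)

end

theory Submission
  imports Defs
begin

text \<open>The free realisation \<open>(C, c)\<close> of \<open>\<phi>\<close> gives, for \<open>F = \<phi>/\<psi>\<close>, an objectwise surjection
  \<open>\<beta> : Hom(C,-) \<rightarrow> F\<close> sending \<open>f : C \<rightarrow> M\<close> to the coset of \<open>f c\<close>. By the Yoneda lemma, a natural
  transformation \<open>F \<rightarrow> Hom(M,-)\<close>, composed with \<open>\<beta>\<close>, is precomposition with some \<open>h : M \<rightarrow> C\<close>;
  conversely, such an \<open>h\<close> comes from \<open>F\<close> exactly when \<open>f \<circ> h = 0\<close> for every \<open>f\<close> killed by \<open>\<beta>\<close>,
  that is, when \<open>h\<close> takes its values in the intersection \<open>W\<close> of the kernels of all these \<open>f\<close>.
  So \<open>W\<close> represents \<open>M \<mapsto> Nat(F, Hom(M,-))\<close>, and it is a defect of \<open>F\<close> (\<open>is_defect_reject\<close>).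
  Any two defects of \<open>F\<close> are isomorphic, so it remains to compute \<open>W\<close>.

  Here \<open>\<beta>\<close> kills \<open>f\<close> iff \<open>f c \<in> \<psi> M\<close>, that is, iff \<open>f c = k d\<close> for some \<open>k : D \<rightarrow> M\<close>. If
  \<open>r \<cdot> d = 0\<close>, then \<open>f (r \<cdot> c) = r \<cdot> f c = k (r \<cdot> d) = 0\<close> for every such \<open>f\<close>, so \<open>r \<cdot> c \<in> W\<close>.
  For the converse, two homomorphisms suffice. The projection of \<open>C\<close> onto the quotient by the
  submodule generated by \<open>c\<close> is killed, since it sends \<open>c\<close> to \<open>0\<close>; hence each element of \<open>W\<close>
  has the form \<open>r \<cdot> c\<close>. Since \<open>d \<in> \<psi> D \<subseteq> \<phi> D\<close>, there is also \<open>g : C \<rightarrow> D\<close> with \<open>g c = d\<close>, which is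
  killed as well; hence \<open>r \<cdot> d = g (r \<cdot> c) = 0\<close>.

  Together the two homomorphisms form a map from \<open>C\<close> into a direct sum whose kernel is \<open>W\<close>. They
  are kept apart because all modules live on one fixed element type: it may have no room for the
  direct sum, but every quotient of \<open>C\<close> can be realised on it (\<open>ex_quotient_module\<close>).\<close>

section \<open>Submodules and quotient modules\<close>

context left_module
begin

lemma smult_zero_left: "x \<in> carrier M \<Longrightarrow> \<zero> \<odot>\<^bsub>M\<^esub> x = \<zero>\<^bsub>M\<^esub>"
  by (metis M.add.r_cancel_one R.l_zero R.zero_closed smult_closed smult_l_distr)

lemma smult_minus_one: "x \<in> carrier M \<Longrightarrow> (\<ominus> \<one>) \<odot>\<^bsub>M\<^esub> x = \<ominus>\<^bsub>M\<^esub> x"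
  by (metis M.minus_equality R.add.inv_closed R.l_neg R.one_closed smult_closed smult_l_distr
      smult_one smult_zero_left)

text \<open>Closure under negation is automatic, because \<open>- x = (- 1) x\<close>.\<close>

lemma submoduleI:
  assumes "S \<subseteq> carrier M" and "\<zero>\<^bsub>M\<^esub> \<in> S"
    and "\<And>x y. \<lbrakk>x \<in> S; y \<in> S\<rbrakk> \<Longrightarrow> x \<oplus>\<^bsub>M\<^esub> y \<in> S"
    and sm: "\<And>r x. \<lbrakk>r \<in> carrier R; x \<in> S\<rbrakk> \<Longrightarrow> r \<odot>\<^bsub>M\<^esub> x \<in> S"
  shows "submodule S R M"
proof -
  have "\<ominus>\<^bsub>M\<^esub> x \<in> S" if "x \<in> S" for x
    using sm[of "\<ominus> \<one>" x] that assms(1) by (auto simp: smult_minus_one)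
  then show ?thesis
    using assms by (intro submodule.intro subgroup.intro submodule_axioms.intro)
      (auto simp flip: a_inv_def)
qed

lemma submodule_left_module:
  assumes "submodule S R M"
  shows "left_module R (M\<lparr>carrier := S\<rparr>)" (is "left_module R ?S")
proof -
  interpret S: submodule S R M by fact
  have sub: "x \<in> carrier M" if "x \<in> S" for x using that S.subset by auto
  have add: "x \<oplus>\<^bsub>M\<^esub> y \<in> S" if "x \<in> S" "y \<in> S" for x y using S.m_closed[OF that] by simp
  have zero: "\<zero>\<^bsub>M\<^esub> \<in> S" using S.one_closed by simp
  have "abelian_group ?S"
  proof (rule abelian_groupI)
    fix x assume "x \<in> carrier ?S"
    then have "x \<in> S" by simp
    moreover have "\<ominus>\<^bsub>M\<^esub> x \<in> S" using S.m_inv_closed[OF \<open>x \<in> S\<close>] by (simp add: a_inv_def)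
    ultimately show "\<exists>y\<in>carrier ?S. y \<oplus>\<^bsub>?S\<^esub> x = \<zero>\<^bsub>?S\<^esub>"
      using M.l_neg[OF sub] by auto
  qed (auto simp: sub add zero M.a_ac)
  then show ?thesis
    by (intro left_module.intro R.ring_axioms left_module_axioms.intro)
       (auto simp: sub smult_l_distr smult_r_distr smult_assoc1)
qed

text \<open>The usual quotient is a module of cosets, on the type \<open>'m set\<close>. A defect is tested only
  against modules on \<open>'m\<close>, so each coset is replaced by a chosen element \<open>q x\<close> of it, and every
  operation is followed by \<open>q\<close>.\<close>

lemma ex_quotient_module:
  assumes "submodule S R M"
  obtains N :: "('r, 'm) module" and p where
    "left_module R N" "p \<in> mod_hom R M N"
    "\<forall>x\<in>carrier M. p x = \<zero>\<^bsub>N\<^esub> \<longleftrightarrow> x \<in> S"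
proof -
  interpret S: submodule S R M by fact
  have sub [simp]: "x \<in> carrier M" if "x \<in> S" for x using that S.subset by auto
  have Sadd [simp]: "x \<oplus>\<^bsub>M\<^esub> y \<in> S" if "x \<in> S" "y \<in> S" for x y using S.m_closed that by auto
  have Szero [simp]: "\<zero>\<^bsub>M\<^esub> \<in> S" using S.one_closed by simp
  have Sneg: "\<ominus>\<^bsub>M\<^esub> x \<in> S" if "x \<in> S" for x
    using S.m_inv_closed[of x] that by (simp flip: a_inv_def)
  define q where "q x = (SOME y. y \<in> S #>\<^bsub>add_monoid M\<^esub> x)" for x
  have q_ex: "\<exists>s\<in>S. q x = s \<oplus>\<^bsub>M\<^esub> x" if "x \<in> carrier M" for x
  proof -
    have "q x \<in> S #>\<^bsub>add_monoid M\<^esub> x"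
      unfolding q_def using M.add.rcos_self[OF that S.subgroup_axioms]
      by (intro someI[of "\<lambda>y. y \<in> S #>\<^bsub>add_monoid M\<^esub> x"]) simp
    then show ?thesis by (auto simp: r_coset_def)
  qed
  have q_add: "q (s \<oplus>\<^bsub>M\<^esub> x) = q x" if "s \<in> S" "x \<in> carrier M" for s x
  proof -
    have "s \<oplus>\<^bsub>M\<^esub> x \<in> S #>\<^bsub>add_monoid M\<^esub> x" using that by (auto simp: r_coset_def)
    then have "S #>\<^bsub>add_monoid M\<^esub> x = S #>\<^bsub>add_monoid M\<^esub> (s \<oplus>\<^bsub>M\<^esub> x)"
      by (rule M.add.repr_independence[OF _ that(2) S.subgroup_axioms])
    then show ?thesis by (simp add: q_def)
  qed
  have q_closed [simp]: "q x \<in> carrier M" if "x \<in> carrier M" for x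
    using q_ex[OF that] that by auto
  have q_l [simp]: "q (q x \<oplus>\<^bsub>M\<^esub> y) = q (x \<oplus>\<^bsub>M\<^esub> y)" if "x \<in> carrier M" "y \<in> carrier M" for x y
    using q_ex[OF that(1)] that by (auto simp: q_add M.a_assoc)
  have q_r [simp]: "q (x \<oplus>\<^bsub>M\<^esub> q y) = q (x \<oplus>\<^bsub>M\<^esub> y)" if "x \<in> carrier M" "y \<in> carrier M" for x y
    using q_l[of y x] that by (simp add: M.a_comm)
  have q_rr: "q (x \<oplus>\<^bsub>M\<^esub> (y \<oplus>\<^bsub>M\<^esub> q z)) = q (x \<oplus>\<^bsub>M\<^esub> (y \<oplus>\<^bsub>M\<^esub> z))"
    if "x \<in> carrier M" "y \<in> carrier M" "z \<in> carrier M" for x y z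
    using q_r[of "x \<oplus>\<^bsub>M\<^esub> y" z] that by (simp add: M.a_assoc)
  have q_s [simp]: "q (r \<odot>\<^bsub>M\<^esub> q x) = q (r \<odot>\<^bsub>M\<^esub> x)" if "r \<in> carrier R" "x \<in> carrier M" for r x
    using q_ex[OF that(2)] that by (auto simp: smult_r_distr q_add)
  have q_q [simp]: "q (q x) = q x" if "x \<in> carrier M" for x
    using q_ex[OF that] that by (auto simp: q_add)
  have q_0: "q x = q \<zero>\<^bsub>M\<^esub> \<longleftrightarrow> x \<in> S" if x: "x \<in> carrier M" for x
  proof
    assume eq: "q x = q \<zero>\<^bsub>M\<^esub>"
    obtain s t where st: "s \<in> S" "q x = s \<oplus>\<^bsub>M\<^esub> x" "t \<in> S" "q \<zero>\<^bsub>M\<^esub> = t \<oplus>\<^bsub>M\<^esub> \<zero>\<^bsub>M\<^esub>"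
      using q_ex x M.zero_closed by metis
    then have "s \<oplus>\<^bsub>M\<^esub> x = t" using eq by simp
    then have "x = \<ominus>\<^bsub>M\<^esub> s \<oplus>\<^bsub>M\<^esub> t" using st x by (auto simp: M.r_neg1)
    then show "x \<in> S" using st Sneg by simp
  next
    assume "x \<in> S"
    then show "q x = q \<zero>\<^bsub>M\<^esub>" using q_add[of x "\<zero>\<^bsub>M\<^esub>"] by simp
  qed
  \<comment> \<open>The fields \<open>mult\<close> and \<open>one\<close> carry no meaning for a module; their values here are arbitrary.\<close>
  define N :: "('r, 'm) module" where
    "N = \<lparr>carrier = q ` carrier M, mult = (\<lambda>x y. x), one = q \<zero>\<^bsub>M\<^esub>, zero = q \<zero>\<^bsub>M\<^esub>,
          add = (\<lambda>x y. q (x \<oplus>\<^bsub>M\<^esub> y)), smult = (\<lambda>r x. q (r \<odot>\<^bsub>M\<^esub> x))\<rparr>"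
  have inv: "\<exists>y\<in>carrier N. y \<oplus>\<^bsub>N\<^esub> x = \<zero>\<^bsub>N\<^esub>" if x: "x \<in> carrier N" for x
  proof -
    obtain z where "z \<in> carrier M" "x = q z" using x by (auto simp: N_def)
    then show ?thesis by (intro bexI[of _ "q (\<ominus>\<^bsub>M\<^esub> z)"]) (auto simp: N_def M.l_neg)
  qed
  have "abelian_group N"
    by (rule abelian_groupI[OF _ _ _ _ _ inv]) (auto simp: N_def M.a_ac q_rr)
  then have "left_module R N"
    by (intro left_module.intro R.ring_axioms left_module_axioms.intro)
       (auto simp: N_def smult_r_distr simp flip: smult_l_distr smult_assoc1)
  moreover have "restrict q (carrier M) \<in> mod_hom R M N"
    by (rule mod_homI) (auto simp: N_def)
  ultimately show ?thesis
    by (rule that) (simp add: N_def q_0)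
qed

end


section \<open>Linear combinations\<close>

context left_module
begin

lemma lincomb_Suc:
  assumes "r \<in> {..<Suc n} \<rightarrow> carrier R" and "c \<in> {..<Suc n} \<rightarrow> carrier M"
  shows "lincomb M (Suc n) r c = r n \<odot>\<^bsub>M\<^esub> c n \<oplus>\<^bsub>M\<^esub> lincomb M n r c"
proof -
  have "(\<lambda>i. r i \<odot>\<^bsub>M\<^esub> c i) \<in> {..<n} \<rightarrow> carrier M" "r n \<odot>\<^bsub>M\<^esub> c n \<in> carrier M"
    using assms by (auto simp: Pi_iff)
  then show ?thesis by (simp add: lincomb_def lessThan_Suc M.finsum_insert)
qed

lemma lincomb_closed:
  assumes "r \<in> {..<n} \<rightarrow> carrier R" and "c \<in> {..<n} \<rightarrow> carrier M"
  shows "lincomb M n r c \<in> carrier M"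
  unfolding lincomb_def using assms by (intro M.finsum_closed) auto

lemma lincomb_cong:
  assumes "\<And>i. i < n \<Longrightarrow> r i = r' i" and "\<And>i. i < n \<Longrightarrow> c i = c' i"
    and "r' \<in> {..<n} \<rightarrow> carrier R" and "c' \<in> {..<n} \<rightarrow> carrier M"
  shows "lincomb M n r c = lincomb M n r' c'"
  unfolding lincomb_def using assms by (intro M.finsum_cong') auto

lemma lincomb_add:
  assumes "r \<in> {..<n} \<rightarrow> carrier R" and "s \<in> {..<n} \<rightarrow> carrier R" and "c \<in> {..<n} \<rightarrow> carrier M"
  shows "lincomb M n (\<lambda>i. r i \<oplus> s i) c = lincomb M n r c \<oplus>\<^bsub>M\<^esub> lincomb M n s c"
proof -
  have "lincomb M n (\<lambda>i. r i \<oplus> s i) c = (\<Oplus>\<^bsub>M\<^esub>i\<in>{..<n}. r i \<odot>\<^bsub>M\<^esub> c i \<oplus>\<^bsub>M\<^esub> s i \<odot>\<^bsub>M\<^esub> c i)"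
    unfolding lincomb_def using assms by (intro M.finsum_cong') (auto simp: smult_l_distr Pi_iff)
  also have "\<dots> = lincomb M n r c \<oplus>\<^bsub>M\<^esub> lincomb M n s c"
    unfolding lincomb_def using assms by (intro M.finsum_addf) auto
  finally show ?thesis .
qed

lemma lincomb_smult:
  assumes "a \<in> carrier R" and "r \<in> {..<n} \<rightarrow> carrier R" and "c \<in> {..<n} \<rightarrow> carrier M"
  shows "lincomb M n (\<lambda>i. a \<otimes> r i) c = a \<odot>\<^bsub>M\<^esub> lincomb M n r c"
  using assms(2,3)
proof (induction n)
  case 0
  then show ?case using assms(1) by (simp add: lincomb_def smult_zero_right)
next
  case (Suc n)
  have [simp]: "r n \<in> carrier R" "c n \<in> carrier M" using Suc.prems by auto
  have rc: "r \<in> {..<n} \<rightarrow> carrier R" "c \<in> {..<n} \<rightarrow> carrier M" using Suc.prems by auto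
  have "(\<lambda>i. a \<otimes> r i) \<in> {..<Suc n} \<rightarrow> carrier R" using Suc.prems assms(1) by auto
  then show ?case
    using Suc.IH[OF rc] Suc.prems assms(1) lincomb_closed[OF rc]
    by (simp add: lincomb_Suc smult_r_distr smult_assoc1)
qed

lemma lincomb_hom:
  assumes N: "left_module R N" and f: "f \<in> mod_hom R M N"
    and "r \<in> {..<n} \<rightarrow> carrier R" and "c \<in> {..<n} \<rightarrow> carrier M"
  shows "f (lincomb M n r c) = lincomb N n r (\<lambda>i. f (c i))"
proof -
  interpret N: left_module R N by fact
  show ?thesis
    using assms(3,4)
  proof (induction n)
    case 0
    then show ?case using mod_hom_zero[OF left_module_axioms N f] by (simp add: lincomb_def)
  next
    case (Suc n)
    have [simp]: "r n \<in> carrier R" "c n \<in> carrier M" using Suc.prems by auto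
    have rc: "r \<in> {..<n} \<rightarrow> carrier R" "c \<in> {..<n} \<rightarrow> carrier M" using Suc.prems by auto
    have "(\<lambda>i. f (c i)) \<in> {..<Suc n} \<rightarrow> carrier N"
      using Suc.prems by (auto intro: mod_homD(2)[OF f])
    then show ?case
      using Suc.IH[OF rc] Suc.prems lincomb_closed[OF rc]
      by (simp add: lincomb_Suc N.lincomb_Suc mod_homD[OF f])
  qed
qed

lemma submodule_lincombs:
  assumes c: "c \<in> {..<n} \<rightarrow> carrier M"
  shows "submodule {lincomb M n r c | r. r \<in> carrier (free_mod R n)} R M"
proof (rule submoduleI)
  let ?S = "{lincomb M n r c | r. r \<in> carrier (free_mod R n)}"
  have mem: "lincomb M n r c \<in> ?S" if r: "r \<in> {..<n} \<rightarrow> carrier R" for r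
  proof (intro CollectI exI conjI)
    show "lincomb M n r c = lincomb M n (restrict r {..<n}) c"
      using r c by (intro lincomb_cong) auto
    show "restrict r {..<n} \<in> carrier (free_mod R n)" using r by (auto simp: free_mod_def)
  qed
  show "?S \<subseteq> carrier M"
    using c by (auto simp: free_mod_def PiE_def intro!: lincomb_closed)
  have "lincomb M n (\<lambda>_. \<zero>) c = (\<Oplus>\<^bsub>M\<^esub>i\<in>{..<n}. \<zero>\<^bsub>M\<^esub>)"
    unfolding lincomb_def using c by (intro M.finsum_cong') (auto simp: smult_zero_left Pi_iff)
  then show "\<zero>\<^bsub>M\<^esub> \<in> ?S"
    using mem[of "\<lambda>_. \<zero>"] by simp
  fix x
  assume "x \<in> ?S"
  then obtain r where r: "r \<in> {..<n} \<rightarrow> carrier R" and x: "x = lincomb M n r c"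
    by (auto simp: free_mod_def PiE_def)
  {
    fix y
    assume "y \<in> ?S"
    then obtain s where s: "s \<in> {..<n} \<rightarrow> carrier R" and y: "y = lincomb M n s c"
      by (auto simp: free_mod_def PiE_def)
    show "x \<oplus>\<^bsub>M\<^esub> y \<in> ?S"
      unfolding x y lincomb_add[OF r s c, symmetric] using r s by (intro mem) auto
  next
    fix a
    assume a: "a \<in> carrier R"
    show "a \<odot>\<^bsub>M\<^esub> x \<in> ?S"
      unfolding x lincomb_smult[OF a r c, symmetric] using a r by (intro mem) auto
  }
qed

lemma in_submodule_lincombs:
  assumes c: "c \<in> {..<n} \<rightarrow> carrier M" and i: "i < n"
  shows "c i \<in> {lincomb M n r c | r. r \<in> carrier (free_mod R n)}"
proof -
  define e where "e = (\<lambda>j\<in>{..<n}. if j = i then \<one> else \<zero>)"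
  have "lincomb M n e c = (\<Oplus>\<^bsub>M\<^esub>j\<in>{..<n}. if i = j then c j else \<zero>\<^bsub>M\<^esub>)"
    unfolding lincomb_def e_def using c
    by (intro M.finsum_cong') (auto simp: smult_zero_left Pi_iff)
  also have "\<dots> = c i"
    using i c by (intro M.finsum_singleton) auto
  finally have "c i = lincomb M n e c" by simp
  moreover have "e \<in> carrier (free_mod R n)" by (auto simp: free_mod_def e_def)
  ultimately show ?thesis by blast
qed

end


section \<open>The defect as a reject\<close>

text \<open>The reject of a class of homomorphisms out of \<open>C\<close> is the intersection of their kernels. Here
  the class consists of the homomorphisms that \<open>\<beta>\<close> kills.\<close>

definition reject ::
    "('r, 'x) ring_scheme \<Rightarrow> ('r, 'm) module \<Rightarrow> ('r, 'm, 'v) mfunctor \<Rightarrow>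
     (('r, 'm) module \<Rightarrow> ('m \<Rightarrow> 'm) \<Rightarrow> 'v) \<Rightarrow> 'm set" where
  "reject R C F \<beta> =
     {x \<in> carrier C. \<forall>M. left_module R M \<longrightarrow>
        (\<forall>f\<in>mod_hom R C M. \<beta> M f = \<one>\<^bsub>obj F M\<^esub> \<longrightarrow> f x = \<zero>\<^bsub>M\<^esub>)}"

lemma rejectD:
  assumes "x \<in> reject R C F \<beta>"
  shows "x \<in> carrier C"
    and "\<lbrakk>left_module R M; f \<in> mod_hom R C M; \<beta> M f = \<one>\<^bsub>obj F M\<^esub>\<rbrakk> \<Longrightarrow> f x = \<zero>\<^bsub>M\<^esub>"
  using assms by (auto simp: reject_def)

lemma reject_submodule:
  assumes "left_module R C"
  shows "submodule (reject R C F \<beta>) R C"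
proof -
  interpret C: left_module R C by fact
  show ?thesis
  proof (rule C.submoduleI)
    show "reject R C F \<beta> \<subseteq> carrier C" "\<zero>\<^bsub>C\<^esub> \<in> reject R C F \<beta>"
      by (auto simp: reject_def mod_hom_zero[OF assms])
  next
    fix x y assume xy: "x \<in> reject R C F \<beta>" "y \<in> reject R C F \<beta>"
    have "f (x \<oplus>\<^bsub>C\<^esub> y) = \<zero>\<^bsub>M\<^esub>"
      if M: "left_module R M" "f \<in> mod_hom R C M" "\<beta> M f = \<one>\<^bsub>obj F M\<^esub>" for M f
    proof -
      interpret M: left_module R M by fact
      have "f x = \<zero>\<^bsub>M\<^esub>" "f y = \<zero>\<^bsub>M\<^esub>"
        using rejectD(2)[OF xy(1) M] rejectD(2)[OF xy(2) M] by auto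
      then show ?thesis using rejectD(1)[OF xy(1)] rejectD(1)[OF xy(2)] by (simp add: mod_homD(3)[OF M(2)])
    qed
    then show "x \<oplus>\<^bsub>C\<^esub> y \<in> reject R C F \<beta>"
      using xy by (auto simp: reject_def)
  next
    fix r x assume r: "r \<in> carrier R" and x: "x \<in> reject R C F \<beta>"
    have "f (r \<odot>\<^bsub>C\<^esub> x) = \<zero>\<^bsub>M\<^esub>"
      if M: "left_module R M" "f \<in> mod_hom R C M" "\<beta> M f = \<one>\<^bsub>obj F M\<^esub>" for M f
    proof -
      interpret M: left_module R M by fact
      show ?thesis
        using rejectD(1)[OF x] rejectD(2)[OF x M] r by (simp add: mod_homD(4)[OF M(2)] M.smult_zero_right)
    qed
    then show "r \<odot>\<^bsub>C\<^esub> x \<in> reject R C F \<beta>"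
      using r x by (auto simp: reject_def)
  qed
qed

text \<open>Restricting a homomorphism \<open>g\<close> to the reject forgets exactly enough to make the result depend
  on \<open>\<beta> g\<close> alone: two homomorphisms with the same image differ by one that \<open>\<beta>\<close> kills. This is the
  unit. It is universal because, by Yoneda, \<open>\<alpha> \<circ> \<beta>\<close> is precomposition with \<open>h = \<alpha> (\<beta> id)\<close>, and
  \<open>\<beta> f = 0\<close> forces \<open>f \<circ> h = \<alpha> (\<beta> f) = 0\<close>, so that \<open>h\<close> lands in the reject. When the killed
  homomorphisms are those factoring through a single \<open>f : C \<rightarrow> B\<close>, the reject is the kernel of \<open>f\<close>
  and the lemma specialises to \<open>is_defect_kernel\<close>.\<close>

lemma is_defect_reject:
  fixes C :: "('a, 'c) module" and F :: "('a, 'c, 'd) mfunctor"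
  assumes C: "left_module R C" and F: "is_functor R F"
    and \<beta>: "nat_trans R (hom_functor R C) F \<beta>"
    and surj: "\<And>M. left_module R M \<Longrightarrow> \<beta> M ` mod_hom R C M = carrier (obj F M)"
  shows "is_defect R F (C\<lparr>carrier := reject R C F \<beta>\<rparr>)" (is "is_defect R F ?W")
proof -
  let ?rej = "reject R C F \<beta>"
  interpret C: left_module R C by fact
  interpret W: submodule ?rej R C by (rule reject_submodule[OF C])
  have Wmod: "left_module R ?W" by (rule C.submodule_left_module[OF W.submodule_axioms])
  have \<beta>hom: "\<beta> M \<in> hom (obj (hom_functor R C) M) (obj F M)" if "left_module R M" for M
    using \<beta> that by (simp add: nat_trans_def)
  have \<beta>nat: "\<beta> N (compose (carrier C) k g) = arr F M N k (\<beta> M g)"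
    if "left_module R M" "left_module R N" "k \<in> mod_hom R M N" "g \<in> mod_hom R C M" for M N k g
    using \<beta> that by (simp add: nat_trans_def hom_functor_def)
  have wd: "g x = g' x"
    if M: "left_module R M" and g: "g \<in> mod_hom R C M" and g': "g' \<in> mod_hom R C M"
      and eq: "\<beta> M g = \<beta> M g'" and x: "x \<in> ?rej" for M g g' x
  proof -
    interpret M: left_module R M by fact
    let ?H = "obj (hom_functor R C) M"
    interpret H: comm_group ?H by (rule hom_functor_comm_group[OF C M])
    interpret FM: comm_group "obj F M" using F M by (simp add: is_functor_def)
    interpret b: group_hom ?H "obj F M" "\<beta> M"
      by unfold_locales (rule \<beta>hom[OF M])
    have gc: "g \<in> carrier ?H" "g' \<in> carrier ?H" using g g' by (auto simp: hom_functor_def)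
    define d where "d = g \<otimes>\<^bsub>?H\<^esub> inv\<^bsub>?H\<^esub> g'"
    have "d \<in> carrier ?H" "\<beta> M d = \<one>\<^bsub>obj F M\<^esub>" using gc eq by (simp_all add: d_def)
    then have d: "d \<in> mod_hom R C M" "\<beta> M d = \<one>\<^bsub>obj F M\<^esub>" by (simp_all add: hom_functor_def)
    have "g = d \<otimes>\<^bsub>?H\<^esub> g'" using gc by (simp add: d_def H.m_assoc)
    then have "g x = d x \<oplus>\<^bsub>M\<^esub> g' x"
      using rejectD(1)[OF x] by (simp add: hom_functor_def)
    also have "d x = \<zero>\<^bsub>M\<^esub>" by (rule rejectD(2)[OF x M d])
    finally show ?thesis using rejectD(1)[OF x] mod_homD(2)[OF g'] by simp
  qed
  define \<eta> where "\<eta> M y = restrict (inv_into (mod_hom R C M) (\<beta> M) y) ?rej" for M y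
  have \<eta>: "\<eta> M (\<beta> M g) = restrict g ?rej" if M: "left_module R M" and g: "g \<in> mod_hom R C M" for M g
  proof -
    have "\<beta> M g \<in> \<beta> M ` mod_hom R C M" using g by simp
    then have "inv_into (mod_hom R C M) (\<beta> M) (\<beta> M g) \<in> mod_hom R C M"
      and "\<beta> M (inv_into (mod_hom R C M) (\<beta> M) (\<beta> M g)) = \<beta> M g"
      by (rule inv_into_into, rule f_inv_into_f)
    from wd[OF M this(1) g this(2)] show ?thesis unfolding \<eta>_def by (rule restrict_ext)
  qed
  have lift: "\<exists>g\<in>mod_hom R C M. y = \<beta> M g" if "left_module R M" "y \<in> carrier (obj F M)" for M y
    using surj[OF that(1)] that(2) by auto
  have res: "restrict g ?rej \<in> mod_hom R ?W M" if g: "g \<in> mod_hom R C M" for M g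
    using W.m_closed W.smult_closed W.subset
    by (intro mod_homI) (auto simp: mod_homD[OF g] subset_iff)
  have \<eta>nat: "nat_trans R F (hom_functor R ?W) \<eta>"
    unfolding nat_trans_def
  proof (intro conjI allI impI ballI)
    fix M :: "('a, 'c) module" assume M: "left_module R M"
    show "\<eta> M \<in> hom (obj F M) (obj (hom_functor R ?W) M)"
    proof (rule homI)
      fix y assume "y \<in> carrier (obj F M)"
      then obtain g where g: "g \<in> mod_hom R C M" "y = \<beta> M g" using lift[OF M] by auto
      show "\<eta> M y \<in> carrier (obj (hom_functor R ?W) M)"
        using res[OF g(1)] by (simp add: g(2) \<eta>[OF M g(1)] hom_functor_def)
    next
      fix y z assume "y \<in> carrier (obj F M)" "z \<in> carrier (obj F M)"
      then obtain g h where g: "g \<in> mod_hom R C M" "y = \<beta> M g" and h: "h \<in> mod_hom R C M" "z = \<beta> M h"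
        using lift[OF M] by metis
      let ?s = "\<lambda>x\<in>carrier C. g x \<oplus>\<^bsub>M\<^esub> h x"
      interpret H: comm_group "obj (hom_functor R C) M" by (rule hom_functor_comm_group[OF C M])
      have s: "?s \<in> mod_hom R C M" using H.m_closed[of g h] g h by (simp add: hom_functor_def)
      have "\<beta> M ?s = y \<otimes>\<^bsub>obj F M\<^esub> z"
        using hom_mult[OF \<beta>hom[OF M], of g h] g h by (simp add: hom_functor_def)
      then have "\<eta> M (y \<otimes>\<^bsub>obj F M\<^esub> z) = restrict ?s ?rej" using \<eta>[OF M s] by simp
      also have "\<dots> = \<eta> M y \<otimes>\<^bsub>obj (hom_functor R ?W) M\<^esub> \<eta> M z"
        by (auto simp: g h \<eta>[OF M g(1)] \<eta>[OF M h(1)] hom_functor_def fun_eq_iff rejectD(1))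
      finally show "\<eta> M (y \<otimes>\<^bsub>obj F M\<^esub> z) = \<eta> M y \<otimes>\<^bsub>obj (hom_functor R ?W) M\<^esub> \<eta> M z" .
    qed
  next
    fix M N :: "('a, 'c) module" and k y
    assume M: "left_module R M" and N: "left_module R N" and k: "k \<in> mod_hom R M N"
      and "y \<in> carrier (obj F M)"
    then obtain g where g: "g \<in> mod_hom R C M" "y = \<beta> M g" using lift[OF M] by auto
    have "arr F M N k y = \<beta> N (compose (carrier C) k g)" using \<beta>nat[OF M N k g(1)] g by simp
    then have "\<eta> N (arr F M N k y) = restrict (compose (carrier C) k g) ?rej"
      using \<eta>[OF N mod_hom_compose[OF C g(1) k]] by simp
    also have "\<dots> = arr (hom_functor R ?W) M N k (\<eta> M y)"
      by (auto simp: g \<eta>[OF M g(1)] hom_functor_def fun_eq_iff compose_def rejectD(1))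
    finally show "\<eta> N (arr F M N k y) = arr (hom_functor R ?W) M N k (\<eta> M y)" .
  qed
  let ?id = "\<lambda>a\<in>carrier C. a"
  have id: "?id \<in> mod_hom R C C" by (rule mod_hom_id[OF C])
  have uni: "\<exists>!h. h \<in> mod_hom R M ?W \<and> (\<forall>N. left_module R N \<longrightarrow>
               (\<forall>x\<in>carrier (obj F N). \<alpha> N x = compose (carrier M) (\<eta> N x) h))"
    if M: "left_module R M" and \<alpha>: "nat_trans R F (hom_functor R M) \<alpha>" for M \<alpha>
  proof -
    have \<alpha>hom: "\<alpha> N \<in> hom (obj F N) (obj (hom_functor R M) N)" if "left_module R N" for N
      using \<alpha> that by (simp add: nat_trans_def)
    have \<alpha>nat: "\<alpha> P (arr F N P k y) = compose (carrier M) k (\<alpha> N y)"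
      if "left_module R N" "left_module R P" "k \<in> mod_hom R N P" "y \<in> carrier (obj F N)" for N P k y
      using \<alpha> that by (simp add: nat_trans_def hom_functor_def)
    have bc: "\<beta> C ?id \<in> carrier (obj F C)" using id surj[OF C] by auto
    \<comment> \<open>The element of \<open>Hom(M, C)\<close> that corresponds to \<open>\<alpha> \<circ> \<beta>\<close> under the Yoneda lemma.\<close>
    let ?h = "\<alpha> C (\<beta> C ?id)"
    have h: "?h \<in> mod_hom R M C"
      using hom_in_carrier[OF \<alpha>hom[OF C] bc] by (simp add: hom_functor_def)
    have yon: "\<alpha> N (\<beta> N g) = compose (carrier M) g ?h"
      if N: "left_module R N" and g: "g \<in> mod_hom R C N" for N g
    proof -
      have "compose (carrier C) g ?id = g"
        using mod_homD(1)[OF g] by (auto simp: compose_def fun_eq_iff extensional_def)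
      then show ?thesis using \<beta>nat[OF C N g id] \<alpha>nat[OF C N g bc] by simp
    qed
    have "f (?h m) = \<zero>\<^bsub>N\<^esub>"
      if N: "left_module R N" and f: "f \<in> mod_hom R C N" "\<beta> N f = \<one>\<^bsub>obj F N\<^esub>"
        and m: "m \<in> carrier M" for N f m
    proof -
      have "group (obj F N)" using F N by (auto simp: is_functor_def comm_group_def)
      then have "compose (carrier M) f ?h = (\<lambda>x\<in>carrier M. \<zero>\<^bsub>N\<^esub>)"
        using yon[OF N f(1)] f(2) hom_one[OF \<alpha>hom[OF N]] hom_functor_comm_group[OF M N]
        by (simp add: hom_functor_def comm_group_def)
      then show ?thesis using m by (auto dest!: fun_cong[where x = m] simp: compose_eq)
    qed
    then have hW: "?h \<in> mod_hom R M ?W"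
      using mod_homD[OF h] by (intro mod_homI) (auto simp: reject_def)
    have fac: "\<alpha> N x = compose (carrier M) (\<eta> N x) ?h"
      if N: "left_module R N" and x: "x \<in> carrier (obj F N)" for N x
    proof -
      obtain g where g: "g \<in> mod_hom R C N" "x = \<beta> N g" using lift[OF N x] by auto
      show ?thesis using mod_homD(2)[OF hW]
        by (auto simp: g yon[OF N g(1)] \<eta>[OF N g(1)] compose_def fun_eq_iff)
    qed
    show ?thesis
    proof (intro ex1I conjI allI impI ballI)
      show "?h \<in> mod_hom R M ?W" by (rule hW)
    next
      fix N x assume "left_module R N" "x \<in> carrier (obj F N)"
      then show "\<alpha> N x = compose (carrier M) (\<eta> N x) ?h" by (rule fac)
    next
      fix h' assume h': "h' \<in> mod_hom R M ?W \<and> (\<forall>N. left_module R N \<longrightarrow>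
               (\<forall>x\<in>carrier (obj F N). \<alpha> N x = compose (carrier M) (\<eta> N x) h'))"
      then have "?h = compose (carrier M) (restrict ?id ?rej) h'"
        using C bc \<eta>[OF C id] by simp
      also have "\<dots> = h'" using mod_homD(1,2)[of h' R M ?W] h' rejectD(1)[of _ R C F \<beta>]
        by (auto simp: compose_def fun_eq_iff extensional_def)
      finally show "h' = ?h" by simp
    qed
  qed
  show ?thesis unfolding is_defect_def
    by (intro conjI exI[of _ \<eta>] allI impI Wmod \<eta>nat uni)
qed


section \<open>Presenting a pp-pair by a free realisation\<close>

lemma nat_trans_compose:
  fixes F :: "('a, 'c, 'd) mfunctor"
  assumes \<alpha>: "nat_trans R F G \<alpha>" and \<beta>: "nat_trans R G H \<beta>"
  shows "nat_trans R F H (\<lambda>M x. \<beta> M (\<alpha> M x))"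
  unfolding nat_trans_def
proof (intro conjI allI impI ballI)
  fix M :: "('a, 'c) module" assume M: "left_module R M"
  have "\<beta> M \<circ> \<alpha> M \<in> hom (obj F M) (obj H M)"
    using \<alpha> \<beta> M by (intro hom_compose[of _ _ "obj G M"]) (auto simp: nat_trans_def)
  then show "(\<lambda>x. \<beta> M (\<alpha> M x)) \<in> hom (obj F M) (obj H M)" by (simp add: comp_def)
next
  fix M N :: "('a, 'c) module" and f x
  assume M: "left_module R M" "left_module R N" "f \<in> mod_hom R M N" "x \<in> carrier (obj F M)"
  moreover have "\<alpha> M x \<in> carrier (obj G M)"
    using \<alpha> M by (auto simp: nat_trans_def hom_def)
  ultimately show "\<beta> N (\<alpha> N (arr F M N f x)) = arr H M N f (\<beta> M (\<alpha> M x))"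
    using \<alpha> \<beta> by (simp add: nat_trans_def)
qed

text \<open>The arrow part of the quotient takes the union over all representatives of a coset. Naturality
  holds because \<open>F f\<close> maps \<open>S M\<close> into \<open>S N\<close>, so all of these contribute the same coset.\<close>

lemma nat_trans_quotient:
  fixes F :: "('a, 'c, 'd) mfunctor"
  assumes F: "is_functor R F" and S: "is_subfunctor R F S"
  shows "nat_trans R F (quotient_functor F S) (\<lambda>M x. S M #>\<^bsub>obj F M\<^esub> x)"
  unfolding nat_trans_def
proof (intro conjI allI impI ballI)
  fix M :: "('a, 'c) module" assume M: "left_module R M"
  interpret comm_group "obj F M" using F M by (simp add: is_functor_def)
  have "S M \<lhd> obj F M"
    using S M by (intro subgroup_imp_normal) (simp add: is_subfunctor_def)
  from normal.r_coset_hom_Mod[OF this]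
  show "(\<lambda>x. S M #>\<^bsub>obj F M\<^esub> x) \<in> hom (obj F M) (obj (quotient_functor F S) M)"
    by (simp add: quotient_functor_def)
next
  fix M N :: "('a, 'c) module" and f x
  assume M: "left_module R M" and N: "left_module R N" and f: "f \<in> mod_hom R M N"
    and x: "x \<in> carrier (obj F M)"
  interpret M: comm_group "obj F M" using F M by (simp add: is_functor_def)
  interpret N: comm_group "obj F N" using F N by (simp add: is_functor_def)
  interpret SM: subgroup "S M" "obj F M" using S M by (simp add: is_subfunctor_def)
  interpret SN: subgroup "S N" "obj F N" using S N by (simp add: is_subfunctor_def)
  have af: "arr F M N f \<in> hom (obj F M) (obj F N)" using F M N f by (simp add: is_functor_def)
  have fx: "arr F M N f x \<in> carrier (obj F N)" using af x by (rule hom_in_carrier)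
  have eq: "S N #>\<^bsub>obj F N\<^esub> arr F M N f y = S N #>\<^bsub>obj F N\<^esub> arr F M N f x"
    if y: "y \<in> S M #>\<^bsub>obj F M\<^esub> x" for y
  proof -
    obtain s where s: "s \<in> S M" "y = s \<otimes>\<^bsub>obj F M\<^esub> x" using y by (auto simp: r_coset_def)
    have fs: "arr F M N f s \<in> S N" using S M N f s(1) unfolding is_subfunctor_def by blast
    have "arr F M N f y = arr F M N f s \<otimes>\<^bsub>obj F N\<^esub> arr F M N f x"
      unfolding s(2) using af s(1) x by (intro hom_mult) auto
    then have "arr F M N f y \<in> S N #>\<^bsub>obj F N\<^esub> arr F M N f x"
      using fs by (auto simp: r_coset_def)
    from N.repr_independence[OF this fx SN.subgroup_axioms] show ?thesis by simp
  qed
  have "x \<in> S M #>\<^bsub>obj F M\<^esub> x" by (rule M.rcos_self[OF x SM.subgroup_axioms])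
  with eq have "(\<Union>y\<in>S M #>\<^bsub>obj F M\<^esub> x. S N #>\<^bsub>obj F N\<^esub> arr F M N f y) = S N #>\<^bsub>obj F N\<^esub> arr F M N f x"
    by blast
  then show "S N #>\<^bsub>obj F N\<^esub> arr F M N f x = arr (quotient_functor F S) M N f (S M #>\<^bsub>obj F M\<^esub> x)"
    by (simp add: quotient_functor_def)
qed

lemma is_subfunctor_mono:
  assumes S: "is_subfunctor R F S" and T: "is_subfunctor R F T"
    and gr: "\<And>M. left_module R M \<Longrightarrow> group (obj F M)"
    and le: "\<And>M. left_module R M \<Longrightarrow> T M \<subseteq> S M"
  shows "is_subfunctor R (subfunctor F S) T"
  using group.subgroup_incl[OF gr] S T le
  by (auto simp: is_subfunctor_def subfunctor_def)

text \<open>The Yoneda transformation determined by the element \<open>c\<close> of \<open>\<phi> C\<close>.\<close>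

lemma nat_trans_evaluation:
  assumes C: "left_module R C" and \<phi>: "is_subfunctor R (forget_power n) \<phi>" and c: "c \<in> \<phi> C"
  shows "nat_trans R (hom_functor R C) (subfunctor (forget_power n) \<phi>)
           (\<lambda>M f. arr (forget_power n) C M f c)"
proof -
  have "subgroup (\<phi> C) (obj (forget_power n) C)" using \<phi> C by (simp add: is_subfunctor_def)
  then have cC: "c \<in> {..<n} \<rightarrow> carrier C"
    using c subgroup.subset by (fastforce simp: forget_power_def PiE_iff)
  have "arr (forget_power n) C M f c \<in> \<phi> M" if "left_module R M" "f \<in> mod_hom R C M" for M f
    using \<phi> C c that unfolding is_subfunctor_def by blast
  then show ?thesis
    using cC by (auto simp: nat_trans_def hom_functor_def subfunctor_def forget_power_def
        compose_def fun_eq_iff Pi_iff intro!: homI)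
qed

theorem proposition5p27:
  fixes R :: "('r, 'x) ring_scheme"
    and n :: nat
    and \<phi> \<psi> :: "('r, 'm) module \<Rightarrow> (nat \<Rightarrow> 'm) set"
    and C D :: "('r, 'm) module"
    and c d :: "nat \<Rightarrow> 'm"
  assumes "ring R"
    and "pp_pair R n \<phi> \<psi>"
    and "in_L R (pp_quotient n \<phi> \<psi>)"
    and "free_realisation R n \<phi> C c"
    and "free_realisation R n \<psi> D d"
  shows "mod_iso R (defect R (pp_quotient n \<phi> \<psi>))
           (C\<lparr>carrier := {lincomb C n r c | r.
                r \<in> carrier (free_mod R n) \<and> lincomb D n r d = \<zero>\<^bsub>D\<^esub>}\<rparr>)"
proof -
  let ?U = "forget_power n :: ('r, 'm, nat \<Rightarrow> 'm) mfunctor"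
  let ?F = "pp_quotient n \<phi> \<psi>"
  have C: "left_module R C" and D: "left_module R D"
    using assms(4,5) by (auto simp: free_realisation_def fin_pres_def)
  interpret C: left_module R C by fact
  interpret D: left_module R D by fact
  have c: "c \<in> {..<n} \<rightarrow>\<^sub>E carrier C" and d: "d \<in> {..<n} \<rightarrow>\<^sub>E carrier D"
    using assms(4,5) by (auto simp: free_realisation_def forget_power_def)
  have cC: "c \<in> {..<n} \<rightarrow> carrier C" and dD: "d \<in> {..<n} \<rightarrow> carrier D"
    using c d by auto
  have \<phi>: "\<phi> M = (\<lambda>f. arr ?U C M f c) ` mod_hom R C M"
    and \<psi>: "\<psi> M = (\<lambda>f. arr ?U D M f d) ` mod_hom R D M"
    if "left_module R M" for M
    using assms(4,5) that by (auto simp: free_realisation_def hom_functor_def)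
  have sub: "is_subfunctor R ?U \<phi>" "is_subfunctor R ?U \<psi>" "is_functor R (subfunctor ?U \<phi>)"
    and le: "\<And>M. left_module R M \<Longrightarrow> \<psi> M \<subseteq> \<phi> M"
    using assms(2) unfolding pp_pair_def pp_formula_def in_L_def by blast+
  have gr: "group (obj ?U M)" if "left_module R M" for M
  proof -
    interpret left_module R M by fact
    show ?thesis by (simp add: forget_power_def)
  qed
  have \<psi>\<phi>: "is_subfunctor R (subfunctor ?U \<phi>) \<psi>"
    using sub gr le by (intro is_subfunctor_mono)
  have F: "is_functor R ?F" using assms(3) by (simp add: in_L_def)
  have c\<phi>: "c \<in> \<phi> C" and d\<psi>: "d \<in> \<psi> D"
  proof -
    have "arr ?U C C (\<lambda>x\<in>carrier C. x) c = c" "arr ?U D D (\<lambda>x\<in>carrier D. x) d = d"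
      using c d by (auto simp: forget_power_def fun_eq_iff PiE_iff extensional_def)
    then show "c \<in> \<phi> C" "d \<in> \<psi> D"
      unfolding \<phi>[OF C] \<psi>[OF D] using mod_hom_id[OF C] mod_hom_id[OF D] by (metis image_eqI)+
  qed
  define \<beta> where
    "\<beta> M f = \<psi> M #>\<^bsub>obj (subfunctor ?U \<phi>) M\<^esub> arr ?U C M f c" for M f
  have \<beta>: "nat_trans R (hom_functor R C) ?F \<beta>"
    using nat_trans_compose[OF nat_trans_evaluation[OF C sub(1) c\<phi>] nat_trans_quotient[OF sub(3) \<psi>\<phi>]]
    unfolding \<beta>_def pp_quotient_def .
  have surj: "\<beta> M ` mod_hom R C M = carrier (obj ?F M)" if M: "left_module R M" for M
    by (auto simp: \<beta>_def pp_quotient_def quotient_functor_def carrier_FactGroup subfunctor_def \<phi>[OF M])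
  have \<beta>1: "\<beta> M f = \<one>\<^bsub>obj ?F M\<^esub> \<longleftrightarrow> arr ?U C M f c \<in> \<psi> M"
    if M: "left_module R M" and f: "f \<in> mod_hom R C M" for M f
  proof -
    interpret P: comm_group "obj (subfunctor ?U \<phi>) M" using sub(3) M by (simp add: is_functor_def)
    have S: "subgroup (\<psi> M) (obj (subfunctor ?U \<phi>) M)" using \<psi>\<phi> M by (simp add: is_subfunctor_def)
    have "arr ?U C M f c \<in> carrier (obj (subfunctor ?U \<phi>) M)"
      using f by (simp add: subfunctor_def \<phi>[OF M])
    then show ?thesis
      using P.coset_join1[of "\<psi> M"] P.coset_join2[of _ "\<psi> M"] S subgroup.subset[OF S]
      by (auto simp: \<beta>_def pp_quotient_def quotient_functor_def)
  qed
  let ?W = "{lincomb C n r c | r. r \<in> carrier (free_mod R n) \<and> lincomb D n r d = \<zero>\<^bsub>D\<^esub>}"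
  have "reject R C ?F \<beta> = ?W"
  proof (intro equalityI subsetI)
    fix x assume x: "x \<in> reject R C ?F \<beta>"
    note xC = rejectD(1)[OF x]
    let ?S = "{lincomb C n r c | r. r \<in> carrier (free_mod R n)}"
    obtain N :: "('r, 'm) module" and p where N: "left_module R N" and p: "p \<in> mod_hom R C N"
      and ker: "\<forall>x\<in>carrier C. p x = \<zero>\<^bsub>N\<^esub> \<longleftrightarrow> x \<in> ?S"
      using C.ex_quotient_module[OF C.submodule_lincombs[OF cC]] by blast
    \<comment> \<open>The projection onto \<open>C / ?S\<close> sends \<open>c\<close> to \<open>0\<close>, so \<open>\<beta>\<close> kills it and it vanishes at \<open>x\<close>.\<close>
    have "p (c i) = \<zero>\<^bsub>N\<^esub>" if "i < n" for i
      by (rule ker[rule_format, THEN iffD2, OF _ C.in_submodule_lincombs[OF cC that]]) (use cC that in auto)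
    then have "arr ?U C N p c = \<one>\<^bsub>obj ?U N\<^esub>"
      by (auto simp: forget_power_def fun_eq_iff)
    moreover have "\<one>\<^bsub>obj ?U N\<^esub> \<in> \<psi> N"
      by (rule subgroup.one_closed) (use sub(2) N in \<open>simp add: is_subfunctor_def\<close>)
    ultimately have "\<beta> N p = \<one>\<^bsub>obj ?F N\<^esub>" unfolding \<beta>1[OF N p] by simp
    then have "p x = \<zero>\<^bsub>N\<^esub>" by (rule rejectD(2)[OF x N p])
    then have "x \<in> ?S" using ker[rule_format, OF xC] by (rule rev_iffD1)
    then obtain r where r: "r \<in> carrier (free_mod R n)" "x = lincomb C n r c" by blast
    \<comment> \<open>The inclusion of \<open>\<psi>\<close> in \<open>\<phi>\<close> provides a homomorphism from \<open>C\<close> to \<open>D\<close> taking \<open>c\<close> to \<open>d\<close>.\<close>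
    have "d \<in> \<phi> D" using le[OF D] d\<psi> by auto
    then obtain g where g: "g \<in> mod_hom R C D" "arr ?U C D g c = d" unfolding \<phi>[OF D] by blast
    have gi: "d i = g (c i)" if "i < n" for i
      using fun_cong[OF g(2), of i] that by (simp add: forget_power_def)
    have rR: "r \<in> {..<n} \<rightarrow> carrier R" using r by (auto simp: free_mod_def)
    have "lincomb D n r d = lincomb D n r (\<lambda>i. g (c i))"
      using rR cC mod_homD(2)[OF g(1)] by (intro D.lincomb_cong gi) auto
    also have "\<dots> = g x" using C.lincomb_hom[OF D g(1) rR cC] r by simp
    also have "\<dots> = \<zero>\<^bsub>D\<^esub>" using rejectD(2)[OF x D g(1)] \<beta>1[OF D g(1)] g(2) d\<psi> by simp
    finally show "x \<in> ?W" using r by blast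
  next
    fix x assume "x \<in> ?W"
    then obtain r where r: "r \<in> carrier (free_mod R n)" "lincomb D n r d = \<zero>\<^bsub>D\<^esub>"
      and x: "x = lincomb C n r c" by auto
    have rR: "r \<in> {..<n} \<rightarrow> carrier R" using r by (auto simp: free_mod_def)
    have "f x = \<zero>\<^bsub>M\<^esub>"
      if M: "left_module R M" and f: "f \<in> mod_hom R C M" "\<beta> M f = \<one>\<^bsub>obj ?F M\<^esub>" for M f
    proof -
      interpret M: left_module R M by fact
      have "arr ?U C M f c \<in> \<psi> M" using \<beta>1[OF M f(1)] f(2) by simp
      then obtain k where k: "k \<in> mod_hom R D M" "arr ?U C M f c = arr ?U D M k d"
        unfolding \<psi>[OF M] by auto
      have "f (c i) = k (d i)" if "i < n" for i
        using fun_cong[OF k(2), of i] that by (simp add: forget_power_def)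
      then have "lincomb M n r (\<lambda>i. f (c i)) = lincomb M n r (\<lambda>i. k (d i))"
        using rR dD mod_homD(2)[OF k(1)] by (intro M.lincomb_cong) auto
      then have "f x = k (lincomb D n r d)"
        using C.lincomb_hom[OF M f(1) rR cC] D.lincomb_hom[OF M k(1) rR dD] x by simp
      then show ?thesis using r(2) mod_hom_zero[OF D M k(1)] by simp
    qed
    then show "x \<in> reject R C ?F \<beta>"
      using C.lincomb_closed[OF rR cC] x by (auto simp: reject_def)
  qed
  with is_defect_reject[OF C F \<beta> surj] have "is_defect R ?F (C\<lparr>carrier := ?W\<rparr>)" by simp
  then show ?thesis
    unfolding defect_def by (intro is_defect_unique) (rule someI)
qed

end
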